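(* For every integer $m\ge 0$, $$p(5m+4)\equiv 0 \pmod 5 \quad\text{and}\quad \tau(5m+5)\equiv 0 \pmod 5 .$$
   Context: For a non-negative integer $n$, $p(n)$ is the number of unordered partitions of $n$, with generating function (as a formal power series) $$\sum_{n=0}^\infty p(n)q^n=\prod_{k=1}^\infty \frac{1}{1-q^k}.$$ Ramanujan's $\tau$ function is the integer-valued function on the positive integers defined by the formal power series identity $$\sum_{n=0}^\infty \tau(n+1)q^n=\prod_{k=1}^\infty(1-q^k)^{24}.$$ *)

theory Defs
  imports
    "HOL-Analysis.Analysis"
    "HOL-Library.Multiset"
    "HOL-Number_Theory.Cong"
    "HOL-Computational_Algebra.Formal_Power_Series"
begin

text \<open>An unordered partition of \<open>n\<close> is a finite multiset of positive integers with sum \<open>n\<close>.\<close>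

definition partitions :: "nat \<Rightarrow> nat multiset set" where
  "partitions n = {M. 0 \<notin># M \<and> sum_mset M = n}"

definition partition_number :: "nat \<Rightarrow> nat" where
  "partition_number n = card (partitions n)"

lemma finite_partitions: "finite (partitions n)"
proof -
  have size_le: "size M \<le> sum_mset M" if "0 \<notin># M" for M :: "nat multiset"
    using that by (induction M) auto
  have "partitions n \<subseteq> mset ` {xs. set xs \<subseteq> {..n} \<and> length xs \<le> n}"
  proof
    fix M assume M: "M \<in> partitions n"
    obtain xs where xs: "M = mset xs" by (metis ex_mset)
    have "set xs \<subseteq> {..n}"
      using M unfolding xs partitions_def by (auto simp: sum_mset_sum_list member_le_sum_list)
    moreover have "length xs \<le> n"
      using M size_le[of M] unfolding xs partitions_def by auto
    ultimately show "M \<in> mset ` {xs. set xs \<subseteq> {..n} \<and> length xs \<le> n}"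
      using xs by blast
  qed
  moreover have "finite (mset ` {xs. set xs \<subseteq> {..n} \<and> length xs \<le> n})"
    by (intro finite_imageI finite_lists_length_le) simp
  ultimately show ?thesis
    by (rule finite_subset)
qed

text \<open>
  The infinite product is taken in the \<open>q\<close>-adic topology on formal power series; since
  \<^const>\<open>prodinf\<close> is indexed from \<open>0\<close>, the factor with index \<open>k\<close> is \<open>(1 - q ^ (k + 1)) ^ 24\<close>.
\<close>

definition tau_series :: "int fps" where
  "tau_series = (\<Prod>k. (1 - fps_X ^ Suc k) ^ 24)"

text \<open>Only positive arguments of \<open>\<tau>\<close> are meaningful.\<close>

definition ramanujan_tau :: "nat \<Rightarrow> int" where
  "ramanujan_tau n = fps_nth tau_series (n - 1)"

lemma tau_series_has_prod: "(\<lambda>k. (1 - fps_X ^ Suc k) ^ 24 :: int fps) has_prod tau_series"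
proof -
  define f :: "nat \<Rightarrow> int fps" where "f k = (1 - fps_X ^ Suc k) ^ 24" for k
  define P where "P N = (\<Prod>i\<le>N. f i)" for N
  define L where "L = Abs_fps (\<lambda>n. fps_nth (P n) n)"
  have f_dvd: "fps_X ^ Suc k dvd f k - 1" for k
  proof -
    have "(1 - fps_X ^ Suc k) - 1 dvd f k - 1 ^ 24"
      unfolding f_def by (subst power_diff_sumr2) (rule dvd_triv_left)
    moreover have "(1 - fps_X ^ Suc k) - 1 = - (fps_X ^ Suc k :: int fps)"
      by simp
    ultimately show ?thesis
      by (metis minus_dvd_iff power_one)
  qed
  have step: "fps_nth (P (Suc N)) n = fps_nth (P N) n" if "n \<le> N" for n N
  proof -
    obtain g where g: "f (Suc N) - 1 = fps_X ^ Suc (Suc N) * g"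
      using f_dvd[of "Suc N"] by (metis dvdE)
    have "P (Suc N) = P N * f (Suc N)"
      by (simp add: P_def mult.commute)
    also have "\<dots> = P N + fps_X ^ Suc (Suc N) * (g * P N)"
      using g by (simp add: algebra_simps)
    finally show ?thesis
      using that by (simp del: power_Suc add: fps_X_power_mult_nth)
  qed
  have stable: "fps_nth (P N) n = fps_nth (P n) n" if "n \<le> N" for n N
    using that by (induction N rule: dec_induct) (auto simp: step)
  have lim: "P \<longlonglongrightarrow> L"
    unfolding tendsto_fps_iff
  proof
    fix n show "\<forall>\<^sub>F N in sequentially. fps_nth (P N) n = fps_nth L n"
      using eventually_ge_at_top[of n] by eventually_elim (unfold L_def fps_nth_Abs_fps, rule stable)
  qed
  have "fps_nth L 0 = 1"
    by (simp add: L_def P_def f_def fps_power_zeroth)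
  hence "L \<noteq> 0" by auto
  with lim have "f has_prod L"
    by (simp add: has_prod_def raw_has_prod_def P_def [abs_def])
  moreover from this have "L = tau_series"
    unfolding tau_series_def f_def by (rule has_prod_unique)
  ultimately show ?thesis
    by (simp add: f_def [abs_def])
qed

lemma tau_generating_function:
  "Abs_fps (\<lambda>n. ramanujan_tau (n + 1)) = (\<Prod>k. (1 - fps_X ^ Suc k) ^ 24)"
  unfolding tau_series_def [symmetric] by (rule fps_ext) (simp add: ramanujan_tau_def)

end

theory Submission
  imports Defs "HOL-Library.Nat_Bijection"
begin

text \<open>
  Let \<open>\<phi> = \<Prod>(1 - q\<^sup>k)\<close>. By Jacobi's identity \<open>\<phi>\<^sup>3 = \<Sum>(-1)\<^sup>k (2k + 1) q\<^bsup>k(k+1)/2\<^esup>\<close>, the terms of \<open>\<phi>\<^sup>3\<close>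
  that survive reduction modulo 5 have exponents congruent to 0 or 1, since \<open>k(k+1)/2 \<equiv> 3\<close> only
  when 5 divides \<open>2k + 1\<close>. So those of \<open>\<phi>\<^sup>9\<close> have exponents congruent to 0, 1, 2 or 3. A fifth
  power is congruent modulo 5 to a series in \<open>q\<^sup>5\<close>, hence neither \<open>\<phi>\<^sup>2\<^sup>4 = \<phi>\<^sup>9 (\<phi>\<^sup>3)\<^sup>5\<close> nor
  \<open>1/\<phi> = \<phi>\<^sup>9 (1/\<phi>\<^sup>2)\<^sup>5\<close> has, modulo 5, a term whose exponent is congruent to 4.

  Jacobi's identity follows by letting \<open>n\<close> tend to infinity in the derivative at \<open>z = 1\<close> of the
  expansion of \<open>(1 - z) \<Prod>\<^sub>1\<^sub>\<le>\<^sub>i\<^sub>\<le>\<^sub>n (1 - z q\<^sup>i) (1 - q\<^sup>i / z)\<close> in powers of \<open>z\<close>.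
\<close>

section \<open>A finite form of Jacobi's identity\<close>

definition euler_prod :: "nat \<Rightarrow> int fps" where
  "euler_prod n = (\<Prod>i<n. 1 - fps_X ^ Suc i)"

lemma euler_prod_0 [simp]: "euler_prod 0 = 1"
  by (simp add: euler_prod_def)

lemma euler_prod_Suc: "euler_prod (Suc n) = euler_prod n * (1 - fps_X ^ Suc n)"
  by (simp add: euler_prod_def)

lemma euler_prod_nonzero [simp]: "euler_prod n \<noteq> 0"
proof -
  have "fps_nth (euler_prod n) 0 = 1"
    by (induction n) (simp_all add: euler_prod_Suc)
  thus ?thesis by auto
qed

text \<open>The factors beyond the first \<open>n\<close> are congruent to 1 modulo X^(n+1).
  Congruences of this kind take the place of a limit of the finite products.\<close>

lemma euler_prod_extend:
  assumes "n \<le> m"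
  obtains r where "euler_prod m = euler_prod n * r" "fps_X ^ Suc n dvd r - 1"
proof -
  have "\<exists>r. euler_prod m = euler_prod n * r \<and> fps_X ^ Suc n dvd r - 1"
    using assms
  proof (induction m rule: dec_induct)
    case base
    show ?case by (intro exI[of _ 1]) simp
  next
    case (step m)
    then obtain r where r: "euler_prod m = euler_prod n * r" "fps_X ^ Suc n dvd r - 1"
      by blast
    have "(fps_X :: int fps) ^ Suc n dvd fps_X ^ Suc m"
      using step.hyps by (intro le_imp_power_dvd) simp
    hence "fps_X ^ Suc n dvd (r - 1) - fps_X ^ Suc m * r"
      by (rule dvd_diff[OF r(2) dvd_mult2])
    also have "(r - 1) - fps_X ^ Suc m * r = r * (1 - fps_X ^ Suc m) - 1"
      by (simp add: algebra_simps)
    finally show ?case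
      using r(1) by (intro exI[of _ "r * (1 - fps_X ^ Suc m)"]) (simp add: euler_prod_Suc mult.assoc)
  qed
  thus ?thesis using that by blast
qed

text \<open>
  \<open>jacobi_coeff n k\<close> is the coefficient of \<open>z\<^sup>-\<^sup>k\<close>, and minus the coefficient of \<open>z\<^sup>k\<^sup>+\<^sup>1\<close>, in
  \<open>F(z) = (1 - z) \<Prod>\<^sub>1\<^sub>\<le>\<^sub>i\<^sub>\<le>\<^sub>n (1 - z q\<^sup>i) (1 - q\<^sup>i / z)\<close>. The recurrence is multiplication by the next two
  factors; the case \<open>k = 0\<close> uses the symmetry \<open>F(1 / z) = - F(z) / z\<close>.
\<close>

fun jacobi_coeff :: "nat \<Rightarrow> nat \<Rightarrow> int fps" where
  "jacobi_coeff 0 k = (if k = 0 then 1 else 0)"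
| "jacobi_coeff (Suc n) 0 =
     (1 + fps_X ^ Suc n + (fps_X ^ Suc n)\<^sup>2) * jacobi_coeff n 0 - fps_X ^ Suc n * jacobi_coeff n 1"
| "jacobi_coeff (Suc n) (Suc k) =
     (1 + (fps_X ^ Suc n)\<^sup>2) * jacobi_coeff n (Suc k)
       - fps_X ^ Suc n * (jacobi_coeff n k + jacobi_coeff n (Suc (Suc k)))"

lemma jacobi_coeff_eq_0: "n < k \<Longrightarrow> jacobi_coeff n k = 0"
  by (induction n k rule: jacobi_coeff.induct) auto

text \<open>For 2 <= j <= N the term \<open>C j\<close> occurs with weights 2j + 3 and 2j - 1, which
  add up to 2(2j + 1). At the lower end \<open>C 1 - C 0\<close> makes up the difference.\<close>

lemma sum_odd_weights_shift:
  fixes C :: "nat \<Rightarrow> 'a :: comm_ring_1"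
  shows "(\<Sum>k\<le>N. of_nat (2 * k + 3) * (C k + C (Suc (Suc k)))) + C 1 - C 0 =
    2 * (\<Sum>k\<le>N. of_nat (2 * k + 1) * C k)
      + of_nat (2 * N + 1) * C (Suc N) + of_nat (2 * N + 3) * C (Suc (Suc N))"
  by (induction N) (simp_all add: algebra_simps numeral_eq_Suc)

text \<open>Both sides are -F'(1): the left one by the expansion of F in powers of z, the right one
  because the factor 1 - z vanishes at z = 1. In the induction the two new factors of F contribute
  (1 - y)^2.\<close>

lemma sum_jacobi_coeff:
  "(\<Sum>k\<le>n. of_nat (2 * k + 1) * jacobi_coeff n k) = (euler_prod n)\<^sup>2"
proof (induction n)
  case 0
  show ?case by simp
next
  case (Suc n)
  define C where "C = jacobi_coeff n"
  define y :: "int fps" where "y = fps_X ^ Suc n"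
  define S where "S = (\<Sum>k\<le>n. of_nat (2 * k + 1) * C k)"
  define U where "U = (\<Sum>k\<le>n. of_nat (2 * k + 3) * C (Suc k))"
  define V where "V = (\<Sum>k\<le>n. of_nat (2 * k + 3) * (C k + C (Suc (Suc k))))"
  have [simp]: "C (Suc n) = 0" "C (Suc (Suc n)) = 0"
    by (simp_all add: C_def jacobi_coeff_eq_0)
  have V: "V + C 1 - C 0 = 2 * S"
    unfolding V_def S_def by (subst sum_odd_weights_shift) simp
  have "(\<Sum>k\<le>Suc n. of_nat (2 * k + 1) * C k) = C 0 + U"
    unfolding U_def by (subst sum.atMost_Suc_shift) (simp add: numeral_eq_Suc)
  hence U: "S = C 0 + U"
    by (simp add: S_def)
  have "(\<Sum>k\<le>Suc n. of_nat (2 * k + 1) * jacobi_coeff (Suc n) k) =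
      jacobi_coeff (Suc n) 0 + (\<Sum>k\<le>n. of_nat (2 * k + 3) * jacobi_coeff (Suc n) (Suc k))"
    by (subst sum.atMost_Suc_shift) (simp add: numeral_eq_Suc)
  also have "(\<Sum>k\<le>n. of_nat (2 * k + 3) * jacobi_coeff (Suc n) (Suc k)) = (1 + y\<^sup>2) * U - y * V"
    unfolding U_def V_def sum_distrib_left sum_subtractf [symmetric]
    by (intro sum.cong refl, simp only: jacobi_coeff.simps C_def [symmetric] y_def [symmetric])
       (simp only: algebra_simps)
  also have "jacobi_coeff (Suc n) 0 = (1 + y + y\<^sup>2) * C 0 - y * C 1"
    by (simp only: jacobi_coeff.simps C_def y_def)
  also have "(1 + y + y\<^sup>2) * C 0 - y * C 1 + ((1 + y\<^sup>2) * U - y * V) =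
      (1 + y\<^sup>2) * (C 0 + U) - y * (V + C 1 - C 0)"
    by (simp add: algebra_simps)
  also have "\<dots> = S * (1 - y)\<^sup>2"
    unfolding V U [symmetric] by (simp add: algebra_simps power2_eq_square)
  also have "S = (euler_prod n)\<^sup>2"
    unfolding S_def C_def by (rule Suc.IH)
  finally show ?case
    by (simp only: euler_prod_Suc power_mult_distrib y_def)
qed

text \<open>A form of the q-binomial theorem free of division: up to sign and a power of X, the
  coefficient is the Gaussian binomial coefficient of 2n + 1 over n - k.\<close>

lemma jacobi_coeff_closed_form:
  assumes "k \<le> n"
  shows "jacobi_coeff n k * euler_prod (n - k) * euler_prod (n + k + 1) =
    (-1) ^ k * fps_X ^ triangle k * euler_prod (2 * n + 1)"
  using assms
proof (induction n arbitrary: k)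
  case 0
  thus ?case by simp
next
  case (Suc n)
  define C where "C = jacobi_coeff n"
  define M where "M = euler_prod (2 * n + 1)"
  define q :: "int fps" where "q = fps_X"
  define y where "y = q ^ Suc n"
  have IH: "C j * euler_prod (n - j) * euler_prod (n + j + 1) = (-1) ^ j * q ^ triangle j * M"
    if "j \<le> n" for j
    using Suc.IH[OF that] by (simp add: C_def M_def q_def)
  have P: "euler_prod (Suc j) = euler_prod j * (1 - q ^ Suc j)" for j
    by (simp only: euler_prod_Suc q_def)
  have M': "euler_prod (2 * Suc n + 1) = M * (1 - y\<^sup>2) * (1 - q * y\<^sup>2)"
  proof -
    have "2 * Suc n + 1 = Suc (Suc (2 * n + 1))" by simp
    moreover have "q ^ Suc (2 * n + 1) = y\<^sup>2" "q ^ Suc (Suc (2 * n + 1)) = q * y\<^sup>2"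
      by (simp_all add: y_def power_mult_distrib mult.commute[of 2] power_mult power2_eq_square)
    ultimately show ?thesis by (simp only: P M_def)
  qed
  \<comment> \<open>This is \<open>IH\<close> at \<open>Suc j\<close> times the factor by which
    \<open>euler_prod (n - j)\<close> exceeds \<open>euler_prod (n - Suc j)\<close>. At
    \<open>j = n\<close> both sides vanish.\<close>
  have IH1: "C (Suc j) * euler_prod (n - j) * euler_prod (n + j + 2) =
      - ((-1) ^ j * q ^ (triangle j + Suc j) * M * (1 - q ^ (n - j)))" if "j \<le> n" for j
  proof (cases "j = n")
    case True
    thus ?thesis by (simp add: C_def jacobi_coeff_eq_0)
  next
    case False
    hence "n - j = Suc (n - Suc j)" using that by simp
    hence A: "euler_prod (n - j) = euler_prod (n - Suc j) * (1 - q ^ (n - j))"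
      using P by metis
    have "C (Suc j) * euler_prod (n - j) * euler_prod (n + j + 2) =
        (C (Suc j) * euler_prod (n - Suc j) * euler_prod (n + j + 2)) * (1 - q ^ (n - j))"
      unfolding A by (simp only: ac_simps)
    also have "C (Suc j) * euler_prod (n - Suc j) * euler_prod (n + j + 2) =
        - ((-1) ^ j * q ^ (triangle j + Suc j) * M)"
      using IH[of "Suc j"] False that by simp
    finally show ?thesis by simp
  qed
  show ?case
  proof (cases k)
    case 0
    have C0: "C 0 * euler_prod n * euler_prod (n + 1) = M"
      using IH[of 0] by simp
    have C1: "C 1 * euler_prod n * euler_prod (n + 2) = - (q * M * (1 - q ^ n))"
      using IH1[of 0] by simp
    have e: "euler_prod (Suc n) = euler_prod n * (1 - y)"
            "euler_prod (n + 2) = euler_prod (n + 1) * (1 - q * y)"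
      using P[of n] P[of "n + 1"] by (simp_all add: y_def)
    have "jacobi_coeff (Suc n) 0 * euler_prod (Suc n) * euler_prod (n + 2) =
       (1 + y + y\<^sup>2) * (C 0 * euler_prod n * euler_prod (n + 1)) * ((1 - y) * (1 - q * y))
        - y * (C 1 * euler_prod n * euler_prod (n + 2)) * (1 - y)"
      unfolding e by (simp add: C_def y_def q_def algebra_simps)
    also have "\<dots> = M * ((1 + y + y\<^sup>2) * (1 - y) * (1 - q * y) + y * (q - y) * (1 - y))"
      unfolding C0 C1 by (simp add: y_def algebra_simps)
    also have "(1 + y + y\<^sup>2) * (1 - y) * (1 - q * y) + y * (q - y) * (1 - y)
        = (1 - y\<^sup>2) * (1 - q * y\<^sup>2)"
      by (simp add: algebra_simps power2_eq_square)
    finally show ?thesis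
      using 0 M' by (simp add: mult.assoc)
  next
    case (Suc j)
    have j: "j \<le> n" using Suc.prems Suc by simp
    define A B where "A = euler_prod (n - j)" and "B = euler_prod (n + j + 1)"
    define s where "s = (-1) ^ j * q ^ triangle j * M"
    \<comment> \<open>As y = v * u, the facts \<open>a\<close>, \<open>b\<close> and
      \<open>d\<close> below reduce the recurrence to a polynomial identity in q, u and v.\<close>
    define v u where "v = q ^ Suc j" and "u = q ^ (n - j)"
    have y: "y = v * u"
      using j by (simp add: y_def v_def u_def flip: power_add)
    have B1: "euler_prod (n + j + 2) = B * (1 - v * y)"
      using P[of "n + j + 1"] by (simp add: B_def v_def y_def power_add ac_simps)
    have B2: "euler_prod (n + j + 3) = B * (1 - v * y) * (1 - q * v * y)"
      using P[of "n + j + 2"] B1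
      by (simp add: v_def y_def power_add ac_simps numeral_eq_Suc)
    have a: "C j * A * B = s"
      using IH[OF j] by (simp add: A_def B_def s_def)
    have b: "C (Suc j) * A * (B * (1 - v * y)) = - (s * v * (1 - u))"
      using IH1[OF j] unfolding B1 A_def s_def v_def u_def by (simp add: power_add ac_simps)
    \<comment> \<open>The factors 1 - u and q - u cover the cases j = n and j = n - 1, where the
      coefficient on the left is 0.\<close>
    have d: "C (Suc (Suc j)) * A * (B * (1 - v * y) * (1 - q * v * y)) =
        s * v * v * (q - u) * (1 - u)"
    proof (cases "j + 2 \<le> n")
      case False
      hence "j = n \<or> Suc j = n" using j by linarith
      hence "u = 1 \<or> u = q" by (auto simp: u_def)
      thus ?thesis using False by (auto simp: C_def jacobi_coeff_eq_0)
    next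
      case True
      then obtain r where r: "n = j + 2 + r" by (metis le_Suc_ex)
      have u': "u = q * q ^ Suc r" by (simp add: u_def r)
      have A: "A = euler_prod r * (1 - q ^ Suc r) * (1 - u)"
        using P[of r] P[of "Suc r"] by (simp add: A_def r u_def)
      have "C (j + 2) * euler_prod r * (B * (1 - v * y) * (1 - q * v * y)) = s * v * v * q"
        using IH[OF True] B2
        by (simp add: r s_def v_def power_add ac_simps numeral_eq_Suc)
      hence "C (j + 2) * A * (B * (1 - v * y) * (1 - q * v * y)) =
          s * v * v * q * (1 - q ^ Suc r) * (1 - u)"
        unfolding A by (simp add: ac_simps)
      thus ?thesis
        unfolding u' by (simp add: algebra_simps)
    qed
    have "jacobi_coeff (Suc n) (Suc j) * A * (B * (1 - v * y) * (1 - q * v * y)) =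
       (1 + y\<^sup>2) * (C (Suc j) * A * (B * (1 - v * y))) * (1 - q * v * y)
        - y * (C j * A * B) * ((1 - v * y) * (1 - q * v * y))
        - y * (C (Suc (Suc j)) * A * (B * (1 - v * y) * (1 - q * v * y)))"
      by (simp only: jacobi_coeff.simps C_def [symmetric] q_def [symmetric] y_def [symmetric])
         (simp only: algebra_simps)
    also have "\<dots> = - (s * v) * ((1 + y\<^sup>2) * (1 - u) * (1 - q * v * y)
        + u * (1 - v * y) * (1 - q * v * y) + y * v * (q - u) * (1 - u))"
      unfolding a b d unfolding y by (simp add: algebra_simps)
    also have "(1 + y\<^sup>2) * (1 - u) * (1 - q * v * y)
        + u * (1 - v * y) * (1 - q * v * y) + y * v * (q - u) * (1 - u) = (1 - y\<^sup>2) * (1 - q * y\<^sup>2)"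
      unfolding y by (simp add: algebra_simps power2_eq_square)
    finally show ?thesis
      using Suc B2 M' unfolding A_def s_def v_def
      by (simp add: power_add ac_simps numeral_eq_Suc q_def)
  qed
qed

text \<open>The quotients \<open>r\<close> and \<open>w\<close> of Euler products are 1 modulo
  X^(n-k+1); the power of X in front regains the missing k orders, since \<open>triangle k\<close>
  is at least k.\<close>

lemma jacobi_coeff_approx:
  assumes "k \<le> n"
  shows "fps_X ^ Suc n dvd jacobi_coeff n k * euler_prod n - (-1) ^ k * fps_X ^ triangle k"
proof -
  obtain r where r: "euler_prod (2 * n + 1) = euler_prod (n + k + 1) * r"
      "fps_X ^ Suc (n + k + 1) dvd r - 1"
    using assms euler_prod_extend[of "n + k + 1" "2 * n + 1"] by auto
  obtain w where w: "euler_prod n = euler_prod (n - k) * w" "fps_X ^ Suc (n - k) dvd w - 1"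
    using euler_prod_extend[of "n - k" n] by auto
  have "jacobi_coeff n k * euler_prod (n - k) = (-1) ^ k * fps_X ^ triangle k * r"
    using jacobi_coeff_closed_form[OF assms] unfolding r(1)
    by (simp add: ac_simps)
  hence eq: "jacobi_coeff n k * euler_prod n - (-1) ^ k * fps_X ^ triangle k
      = (-1) ^ k * (fps_X ^ triangle k * (w * (r - 1) + (w - 1)))"
    unfolding w(1) by (simp add: algebra_simps)
  have "fps_X ^ Suc (n - k) dvd r - 1"
    using r(2) by (rule power_le_dvd) simp
  hence "fps_X ^ Suc (n - k) dvd w * (r - 1) + (w - 1)"
    using w(2) by simp
  hence "fps_X ^ (triangle k + Suc (n - k)) dvd fps_X ^ triangle k * (w * (r - 1) + (w - 1))"
    unfolding power_add by (rule mult_dvd_mono[OF dvd_refl])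
  moreover have "k \<le> triangle k"
    by (induction k) simp_all
  ultimately have "fps_X ^ Suc n dvd fps_X ^ triangle k * (w * (r - 1) + (w - 1))"
    using assms by (elim power_le_dvd) simp
  thus ?thesis unfolding eq by (rule dvd_mult)
qed

text \<open>Jacobi's identity up to order n: \<open>sum_jacobi_coeff\<close> is multiplied by one
  more \<open>euler_prod n\<close> and then approximated term by term.\<close>

lemma euler_prod_cubed_approx:
  "fps_X ^ Suc n dvd
    euler_prod n ^ 3 - (\<Sum>k\<le>n. of_nat (2 * k + 1) * ((-1) ^ k * fps_X ^ triangle k))"
proof -
  have "euler_prod n ^ 3 = (\<Sum>k\<le>n. of_nat (2 * k + 1) * (jacobi_coeff n k * euler_prod n))"
    unfolding power3_eq_cube power2_eq_square [symmetric] sum_jacobi_coeff [symmetric]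
    by (simp only: sum_distrib_right mult.assoc)
  hence "euler_prod n ^ 3 - (\<Sum>k\<le>n. of_nat (2 * k + 1) * ((-1) ^ k * fps_X ^ triangle k)) =
      (\<Sum>k\<le>n. of_nat (2 * k + 1) *
        (jacobi_coeff n k * euler_prod n - (-1) ^ k * fps_X ^ triangle k))"
    by (simp add: right_diff_distrib sum_subtractf)
  also have "fps_X ^ Suc n dvd \<dots>"
    by (intro dvd_sum dvd_mult jacobi_coeff_approx) simp
  finally show ?thesis .
qed

section \<open>Supports modulo 5\<close>

text \<open>The range stops at \<open>n\<close> because the cube of a finite product follows
  Jacobi's series only that far. Bounding residues, rather than listing them, makes the bounds add
  under multiplication.\<close>

definition supported_mod5 :: "nat \<Rightarrow> nat \<Rightarrow> int fps \<Rightarrow> bool" where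
  "supported_mod5 n a f \<longleftrightarrow> (\<forall>i\<le>n. \<not> 5 dvd fps_nth f i \<longrightarrow> i mod 5 \<le> a)"

lemma supported_mod5_mult:
  assumes "supported_mod5 n a f" "supported_mod5 n b g"
  shows "supported_mod5 n (a + b) (f * g)"
  unfolding supported_mod5_def
proof (intro allI impI)
  fix i assume i: "i \<le> n" "\<not> 5 dvd fps_nth (f * g) i"
  have "\<exists>j\<in>{0..i}. \<not> 5 dvd fps_nth f j * fps_nth g (i - j)"
    using i(2) unfolding fps_mult_nth by (meson dvd_sum)
  then obtain j where "j \<le> i" "\<not> 5 dvd fps_nth f j * fps_nth g (i - j)"
    by auto
  hence j: "j \<le> i" "\<not> 5 dvd fps_nth f j" "\<not> 5 dvd fps_nth g (i - j)"
    by (meson dvd_mult dvd_mult2)+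
  hence "j mod 5 \<le> a" "(i - j) mod 5 \<le> b"
    using assms i(1) by (auto simp: supported_mod5_def)
  moreover have "i mod 5 \<le> j mod 5 + (i - j) mod 5"
    using j(1) by (metis le_add_diff_inverse mod_add_eq mod_less_eq_dividend)
  ultimately show "i mod 5 \<le> a + b" by simp
qed

lemma supported_mod5_power:
  assumes "supported_mod5 n a f"
  shows "supported_mod5 n (k * a) (f ^ k)"
proof (induction k)
  case 0
  show ?case by (simp add: supported_mod5_def)
next
  case (Suc k)
  thus ?case using supported_mod5_mult[OF assms Suc.IH] by simp
qed

text \<open>Differentiating \<open>f\<^sup>5\<close> brings down a factor 5.\<close>

lemma supported_mod5_fifth_power: "supported_mod5 n 0 (f ^ 5)"
  unfolding supported_mod5_def
proof (intro allI impI)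
  fix i assume ndvd: "\<not> 5 dvd fps_nth (f ^ 5) i"
  show "i mod 5 \<le> 0"
  proof (cases i)
    case (Suc j)
    have "int i * fps_nth (f ^ 5) i = fps_nth (fps_deriv (f ^ 5)) j"
      by (simp add: Suc)
    also have "fps_deriv (f ^ 5) = fps_const 5 * (fps_deriv f * f ^ 4)"
      by (simp add: fps_deriv_power' numeral_fps_const)
    also have "5 dvd fps_nth \<dots> j"
      by simp
    finally have "5 dvd int i * fps_nth (f ^ 5) i" .
    moreover have "prime (5 :: int)" by simp
    ultimately have "5 dvd int i"
      using ndvd prime_dvd_mult_iff by blast
    thus ?thesis by presburger
  qed simp
qed

lemma triangle_mod5:
  assumes "\<not> 5 dvd 2 * k + 1"
  shows "triangle k mod 5 \<le> 1"
proof -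
  have k: "k mod 5 \<in> {0, 1, 3, 4}"
    using assms by (simp; presburger)
  \<comment> \<open>Since 2 is invertible modulo 5, it suffices to find the residue of the double,
    which avoids the division by 2.\<close>
  have "2 * triangle k = k * Suc k"
    by (simp add: triangle_def)
  hence "(2 * triangle k) mod 5 = ((k mod 5) * Suc (k mod 5)) mod 5"
    by (metis mod_mult_eq mod_Suc_eq mod_mod_trivial)
  hence "(2 * triangle k) mod 5 \<in> {0, 2}"
    using k by auto
  hence "(2 * triangle k) mod 5 = 0 \<or> (2 * triangle k) mod 5 = 2"
    by simp
  thus ?thesis by presburger
qed

lemma supported_mod5_euler_prod_cubed: "supported_mod5 n 1 (euler_prod n ^ 3)"
  unfolding supported_mod5_def
proof (intro allI impI)
  fix i assume i: "i \<le> n" "\<not> 5 dvd fps_nth (euler_prod n ^ 3) i"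
  define J :: "int fps"
    where "J = (\<Sum>k\<le>n. of_nat (2 * k + 1) * ((-1) ^ k * fps_X ^ triangle k))"
  obtain g where "euler_prod n ^ 3 - J = fps_X ^ Suc n * g"
    using euler_prod_cubed_approx[of n] unfolding J_def by (elim dvdE)
  hence "fps_nth (euler_prod n ^ 3 - J) i = 0"
    using i(1) by (simp del: power_Suc add: fps_X_power_mult_nth)
  hence "fps_nth (euler_prod n ^ 3) i = fps_nth J i"
    by simp
  also have "J = (\<Sum>k\<le>n. fps_const (int (2 * k + 1) * (-1) ^ k) * fps_X ^ triangle k)"
    unfolding J_def
    by (intro sum.cong refl)
       (simp only: fps_of_nat fps_const_mult [symmetric] fps_const_power [symmetric]
         fps_const_neg [symmetric] fps_const_1_eq_1 of_nat_eq_id mult.assoc)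
  finally have "\<not> 5 dvd (\<Sum>k\<le>n. int (2 * k + 1) * (-1) ^ k * (if i = triangle k then 1 else 0))"
    using i(2) by (simp add: fps_sum_nth del: of_nat_add of_nat_mult)
  then obtain k where k: "\<not> 5 dvd int (2 * k + 1) * (-1) ^ k * (if i = triangle k then 1 else 0)"
    by (meson dvd_sum)
  hence "i = triangle k" by (auto split: if_splits)
  moreover have "\<not> 5 dvd int (2 * k + 1)"
    using k by (metis dvd_mult2)
  hence "\<not> 5 dvd 2 * k + 1"
    by presburger
  ultimately show "i mod 5 \<le> 1"
    using triangle_mod5 by simp
qed

text \<open>The free \<open>f\<close> serves both congruences: it becomes
  \<open>partition_fps n\<close> for p and \<open>euler_prod n\<close> for tau.\<close>

lemma dvd_nth_euler_prod_ninth_mult: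
  assumes "n mod 5 = 4" "5 dvd k"
  shows "5 dvd fps_nth (euler_prod n ^ 9 * f ^ k) n"
proof -
  from assms(2) obtain j where j: "k = 5 * j" ..
  \<comment> \<open>The bound is 3, which excludes the residue 4 of \<open>n\<close>.\<close>
  have "supported_mod5 n (3 * 1 + j * 0) ((euler_prod n ^ 3) ^ 3 * (f ^ 5) ^ j)"
    by (intro supported_mod5_mult supported_mod5_power supported_mod5_euler_prod_cubed
        supported_mod5_fifth_power)
  thus ?thesis
    using assms(1) by (auto simp: supported_mod5_def j simp flip: power_mult)
qed

section \<open>The generating function of partitions\<close>

text \<open>With parts at most \<open>k\<close> the generating function is exactly the inverse of
  \<open>euler_prod k\<close>; for the coefficient at \<open>n\<close> the choice
  \<open>k = n\<close> loses no partition.\<close>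

definition partitions_le :: "nat \<Rightarrow> nat \<Rightarrow> nat multiset set" where
  "partitions_le k n = {M \<in> partitions n. set_mset M \<subseteq> {..k}}"

lemma finite_partitions_le [simp]: "finite (partitions_le k n)"
  by (simp add: partitions_le_def finite_partitions)

lemma partitions_le_0: "partitions_le 0 n = (if n = 0 then {{#}} else {})"
proof -
  have "M = {#}" if "M \<in> partitions_le 0 n" for M
    using that by (cases M) (auto simp: partitions_le_def partitions_def)
  moreover have "{#} \<in> partitions_le 0 n \<longleftrightarrow> n = 0"
    by (auto simp: partitions_le_def partitions_def)
  ultimately show ?thesis by auto
qed

lemma partitions_le_self: "partitions_le n n = partitions n"
  by (auto simp: partitions_le_def partitions_def dest!: multi_member_split)

text \<open>The partitions containing the part k + 1 correspond, by removal of one copy of it, to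
  those of n - (k + 1) with the same bound on the parts.\<close>

lemma card_partitions_le_Suc:
  "card (partitions_le (Suc k) n) =
    card (partitions_le k n) + (if Suc k \<le> n then card (partitions_le (Suc k) (n - Suc k)) else 0)"
proof -
  define A where "A = {M \<in> partitions_le (Suc k) n. Suc k \<in># M}"
  have split: "partitions_le (Suc k) n = partitions_le k n \<union> A"
    by (auto simp: partitions_le_def A_def le_Suc_eq)
  have "finite A"
    unfolding A_def by (rule finite_subset[OF _ finite_partitions_le]) auto
  moreover have "partitions_le k n \<inter> A = {}"
    by (auto simp: A_def partitions_le_def)
  ultimately have "card (partitions_le (Suc k) n) = card (partitions_le k n) + card A"
    unfolding split by (intro card_Un_disjoint) auto
  moreover have "card A = (if Suc k \<le> n then card (partitions_le (Suc k) (n - Suc k)) else 0)"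
  proof (cases "Suc k \<le> n")
    case True
    have "bij_betw (add_mset (Suc k)) (partitions_le (Suc k) (n - Suc k)) A"
      using True
      by (intro bij_betwI[where g = "\<lambda>M. M - {#Suc k#}"])
         (auto simp: A_def partitions_le_def partitions_def dest!: multi_member_split)
    thus ?thesis using True by (simp add: bij_betw_same_card)
  next
    case False
    hence "A = {}"
      by (auto simp: A_def partitions_le_def partitions_def dest!: multi_member_split)
    thus ?thesis using False by simp
  qed
  ultimately show ?thesis by simp
qed

definition partition_fps :: "nat \<Rightarrow> int fps" where
  "partition_fps k = Abs_fps (\<lambda>n. int (card (partitions_le k n)))"

lemma partition_fps_mult_euler_prod: "partition_fps k * euler_prod k = 1"
proof (induction k)
  case 0
  have "partition_fps 0 = 1"
    by (rule fps_ext) (simp add: partition_fps_def partitions_le_0)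
  thus ?case by simp
next
  case (Suc k)
  have "partition_fps (Suc k) = partition_fps k + fps_X ^ Suc k * partition_fps (Suc k)"
    by (rule fps_ext)
       (auto simp: partition_fps_def card_partitions_le_Suc fps_X_power_mult_nth simp del: power_Suc)
  hence "partition_fps (Suc k) * (1 - fps_X ^ Suc k) = partition_fps k"
    by (simp add: algebra_simps)
  thus ?case
    using Suc.IH by (simp only: euler_prod_Suc ac_simps)
qed

lemma partition_number_eq_nth: "int (partition_number n) = fps_nth (partition_fps n) n"
  by (simp add: partition_number_def partition_fps_def partitions_le_self)

text \<open>Convergence makes each coefficient eventually constant along the partial products, and
  the factors beyond the first \<open>n\<close> do not affect the coefficient at
  \<open>n\<close>.\<close>

lemma ramanujan_tau_eq_nth: "ramanujan_tau (Suc n) = fps_nth (euler_prod n ^ 24) n"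
proof -
  have "(\<lambda>N. \<Prod>k\<le>N. (1 - fps_X ^ Suc k) ^ 24 :: int fps) \<longlonglongrightarrow> tau_series"
    using tau_series_has_prod by (rule has_prod_imp_tendsto)
  hence "\<forall>\<^sub>F N in sequentially.
      fps_nth (\<Prod>k\<le>N. (1 - fps_X ^ Suc k) ^ 24 :: int fps) n = fps_nth tau_series n"
    by (simp only: tendsto_fps_iff)
  hence "\<forall>\<^sub>F N in sequentially. n \<le> N \<and>
      fps_nth (\<Prod>k\<le>N. (1 - fps_X ^ Suc k) ^ 24 :: int fps) n = fps_nth tau_series n"
    using eventually_ge_at_top[of n] by eventually_elim simp
  then obtain N where N: "n \<le> N"
      "fps_nth (\<Prod>k\<le>N. (1 - fps_X ^ Suc k) ^ 24 :: int fps) n = fps_nth tau_series n"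
    using eventually_happens'[OF sequentially_bot] by blast
  have prod: "(\<Prod>k\<le>N. (1 - fps_X ^ Suc k) ^ 24) = euler_prod (Suc N) ^ 24"
    by (simp only: euler_prod_def prod_power_distrib lessThan_Suc_atMost)
  obtain r where r: "euler_prod (Suc N) = euler_prod n * r" "fps_X ^ Suc n dvd r - 1"
    using N(1) euler_prod_extend[of n "Suc N"] by auto
  have "r - 1 dvd r ^ 24 - 1"
    using power_diff_1_eq[of r 24] by simp
  hence "fps_X ^ Suc n dvd euler_prod n ^ 24 * (r ^ 24 - 1)"
    using r(2) by (meson dvd_mult dvd_trans)
  then obtain g where "euler_prod n ^ 24 * (r ^ 24 - 1) = fps_X ^ Suc n * g"
    by (elim dvdE)
  hence "euler_prod (Suc N) ^ 24 = euler_prod n ^ 24 + fps_X ^ Suc n * g"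
    unfolding r(1) power_mult_distrib by (simp add: algebra_simps)
  hence "fps_nth (euler_prod (Suc N) ^ 24) n = fps_nth (euler_prod n ^ 24) n"
    by (simp del: power_Suc add: fps_X_power_mult_nth)
  thus ?thesis
    using N(2) unfolding prod by (simp add: ramanujan_tau_def)
qed

theorem mainTheorem1:
  fixes m :: nat
  shows "[partition_number (5 * m + 4) = 0] (mod 5) \<and> [ramanujan_tau (5 * m + 5) = 0] (mod 5)"
proof
  define n where "n = 5 * m + 4"
  have n: "n mod 5 = 4" by (simp add: n_def)
  let ?P = "euler_prod n" and ?G = "partition_fps n"
  \<comment> \<open>As \<open>?G\<close> inverts \<open>?P\<close>, the exponent of
    \<open>?G\<close> must be 1 more than 9, and 10 is a multiple of 5.\<close>
  have "?P ^ 9 * ?G ^ 10 = ?G * (?G * ?P) ^ 9"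
    by (simp add: power_mult_distrib eval_nat_numeral ac_simps)
  also have "\<dots> = ?G"
    by (simp add: partition_fps_mult_euler_prod)
  finally have "5 dvd int (partition_number n)"
    using dvd_nth_euler_prod_ninth_mult[OF n, of 10 ?G] by (simp add: partition_number_eq_nth)
  hence "5 dvd partition_number n"
    by presburger
  thus "[partition_number (5 * m + 4) = 0] (mod 5)"
    by (simp add: cong_0_iff n_def)
  \<comment> \<open>Here 24 = 9 + 15.\<close>
  have "5 dvd fps_nth (?P ^ 24) n"
    using dvd_nth_euler_prod_ninth_mult[OF n, of 15 ?P] by (simp flip: power_add)
  hence "5 dvd ramanujan_tau (Suc n)"
    by (simp only: ramanujan_tau_eq_nth)
  thus "[ramanujan_tau (5 * m + 5) = 0] (mod 5)"
    by (simp add: cong_0_iff n_def add.commute)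
qed

end
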